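(* (a) Suppose that $e_i(n)\notin\mathrm{span}(X)$ for every $i\in I_1(\mathfrak M_0^{lin})$. Let $C^*=\max\{T_{uc}(\mu_0+e_i(n)): i\in I_1(\mathfrak M_0^{lin})\}$ for $\mu_0\in\mathfrak M_0$ (which does not depend on the choice of $\mu_0\in\mathfrak M_0$). Then, for $0<\alpha<1$, any real $C(\alpha)$ satisfying $$\sup_{\mu_0\in\mathfrak M_0}\ \sup_{0<\sigma^2<\infty}\ \sup_{\Sigma\in\mathfrak C_{Het}} P_{\mu_0,\sigma^2\Sigma}(T_{uc}\ge C(\alpha))\le\alpha$$ necessarily satisfies $C(\alpha)\ge C^*$. In fact, for any $C<C^*$ we have $\sup_{\Sigma\in\mathfrak C_{Het}}P_{\mu_0,\sigma^2\Sigma}(T_{uc}\ge C)=1$ for every $\mu_0\in\mathfrak M_0$ and every $\sigma^2\in(0,\infty)$. (b) Suppose that Assumption 1 (see context) is satisfied and that $e_i(n)\notin\mathsf B$ for every $i\in I_1(\mathfrak M_0^{lin})$. Let $C^*=\max\{T_{Het}(\mu_0+e_i(n)): i\in I_1(\mathfrak M_0^{lin})\}$ for $\mu_0\in\mathfrak M_0$ (which does not depend on the choice of $\mu_0\in\mathfrak M_0$). Then, for $0<\alpha<1$, any real $C(\alpha)$ satisfying $$\sup_{\mu_0\in\mathfrak M_0}\ \sup_{0<\sigma^2<\infty}\ \sup_{\Sigma\in\mathfrak C_{Het}} P_{\mu_0,\sigma^2\Sigma}(T_{Het}\ge C(\alpha))\le\alpha$$ necessarily satisfies $C(\alpha)\ge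 C^*$. In fact, for any $C<C^*$ we have $\sup_{\Sigma\in\mathfrak C_{Het}}P_{\mu_0,\sigma^2\Sigma}(T_{Het}\ge C)=1$ for every $\mu_0\in\mathfrak M_0$ and every $\sigma^2\in(0,\infty)$.
   Context: Setting. $n,k,q$ are integers with $1\le k<n$ and $q\ge1$; $X\in\mathbb R^{n\times k}$ has rank $k$, $R\in\mathbb R^{q\times k}$ has rank $q$, and $r\in\mathbb R^q$; all are fixed. $A'$ is the transpose of $A$, $\mathrm{span}(A)$ the column space, $e_i(n)$ the $i$-th standard basis vector of $\mathbb R^n$. $\mathfrak M_0=\{X\beta:\beta\in\mathbb R^k, R\beta=r\}$, $\mathfrak M_0^{lin}=\{X\beta: R\beta=0\}$. $I_0(\mathfrak M_0^{lin})=\{i\in\{1,\dots,n\}: e_i(n)\in\mathfrak M_0^{lin}\}$ and $I_1(\mathfrak M_0^{lin})=\{1,\dots,n\}\setminus I_0(\mathfrak M_0^{lin})$ (nonempty since $\dim\mathfrak M_0^{lin}=k-q<n$). $P_{\mu,A}$ is the Gaussian measure on $\mathbb R^n$ with mean $\mu$ and covariance matrix $A$. $$\mathfrak C_{Het}=\Big\{\mathrm{diag}(\tau_1^2,\dots,\tau_n^2): \tau_i^2>0\text{ for all } i,\ \sum_{i=1}^n\tau_i^2=1\Big\}.$$ $\hat\beta(y)=(X'X)^{-1}X'y$, $\hat u(y)=y-X\hat\beta(y)$ for $y\in\mathbb R^n$. Test statistics. With $\hat\sigma^2(y)=\hat u(y)'\hat u(y)/(n-k)$, $$T_{uc}(y)=(R\hat\beta(y)-r)'\big(\hat\sigma^2(y)R(X'X)^{-1}R'\big)^{-1}(R\hat\beta(y)-r)\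 \text{ if } y\notin\mathrm{span}(X),\qquad T_{uc}(y)=0\ \text{ if } y\in\mathrm{span}(X).$$ With fixed constants $d_1,\dots,d_n>0$ (possibly depending on $X$) and $\hat\Omega_{Het}(y)=R(X'X)^{-1}X'\,\mathrm{diag}(d_1\hat u_1^2(y),\dots,d_n\hat u_n^2(y))\,X(X'X)^{-1}R'$, $$T_{Het}(y)=(R\hat\beta(y)-r)'\hat\Omega_{Het}^{-1}(y)(R\hat\beta(y)-r)\ \text{ if }\det\hat\Omega_{Het}(y)\ne0,\qquad T_{Het}(y)=0\ \text{ otherwise}.$$ Assumption 1. Let $X'(\lnot)$ be the matrix obtained from $X'$ by deleting all columns with index $i$ such that $e_i(n)\in\mathrm{span}(X)$ (no column is deleted if there is no such $i$). Then $\mathrm{rank}(R(X'X)^{-1}X'(\lnot))=q$. The set $\mathsf B$: $\mathsf B=\{y\in\mathbb R^n:\mathrm{rank}(B(y))<q\}$ with $B(y)=R(X'X)^{-1}X'\,\mathrm{diag}(\hat u_1(y),\dots,\hat u_n(y))$. *)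

theory Defs
  imports "HOL-Analysis.Analysis"
begin

text \<open>
  An n-by-k matrix is an element of \<open>real ^ 'k ^ 'n\<close>, with n = \<open>CARD('n)\<close> and
  k = \<open>CARD('k)\<close>; the standard basis vector e_i is \<open>axis i 1\<close> and the column space
  of \<open>A\<close> is \<open>span (columns A)\<close>.
\<close>

definition diag_mat :: "real ^ 'n \<Rightarrow> real ^ 'n ^ 'n" where
  "diag_mat v = (\<chi> i j. if i = j then v $ i else 0)"

text \<open>The density formula presupposes that the covariance matrix \<open>A\<close> is positive definite.\<close>

definition gaussian :: "real ^ 'n \<Rightarrow> real ^ 'n ^ 'n \<Rightarrow> (real ^ 'n) measure" where
  "gaussian \<mu> A = density lborel (\<lambda>y. ennreal
     (1 / sqrt ((2 * pi) ^ CARD('n) * det A) *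
      exp (- ((y - \<mu>) \<bullet> (matrix_inv A *v (y - \<mu>))) / 2)))"

definition C_Het :: "(real ^ 'n ^ 'n) set" where
  "C_Het = {diag_mat (\<chi> i. (\<tau> $ i)\<^sup>2) | \<tau> :: real ^ 'n.
     (\<forall>i. (\<tau> $ i)\<^sup>2 > 0) \<and> (\<Sum>i\<in>UNIV. (\<tau> $ i)\<^sup>2) = 1}"

definition M0 :: "real ^ 'k ^ 'n \<Rightarrow> real ^ 'k ^ 'q \<Rightarrow> real ^ 'q \<Rightarrow> (real ^ 'n) set" where
  "M0 X R r = {X *v \<beta> | \<beta>. R *v \<beta> = r}"

definition M0_lin :: "real ^ 'k ^ 'n \<Rightarrow> real ^ 'k ^ 'q \<Rightarrow> (real ^ 'n) set" where
  "M0_lin X R = {X *v \<beta> | \<beta>. R *v \<beta> = 0}"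

definition I0 :: "(real ^ 'n) set \<Rightarrow> 'n set" where
  "I0 L = {i. axis i 1 \<in> L}"

definition I1 :: "(real ^ 'n) set \<Rightarrow> 'n set" where
  "I1 L = UNIV - I0 L"

definition beta_hat :: "real ^ 'k ^ 'n \<Rightarrow> real ^ 'n \<Rightarrow> real ^ 'k" where
  "beta_hat X y = matrix_inv (transpose X ** X) *v (transpose X *v y)"

definition u_hat :: "real ^ 'k ^ 'n \<Rightarrow> real ^ 'n \<Rightarrow> real ^ 'n" where
  "u_hat X y = y - X *v beta_hat X y"

definition sigma2_hat :: "real ^ 'k ^ 'n \<Rightarrow> real ^ 'n \<Rightarrow> real" where
  "sigma2_hat X y = (u_hat X y \<bullet> u_hat X y) / (real CARD('n) - real CARD('k))"

definition T_uc ::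
    "real ^ 'k ^ 'n \<Rightarrow> real ^ 'k ^ 'q \<Rightarrow> real ^ 'q \<Rightarrow> real ^ 'n \<Rightarrow> real" where
  "T_uc X R r y =
     (if y \<notin> span (columns X)
      then (R *v beta_hat X y - r) \<bullet>
        (matrix_inv (sigma2_hat X y *\<^sub>R
            (R ** matrix_inv (transpose X ** X) ** transpose R))
          *v (R *v beta_hat X y - r))
      else 0)"

definition Omega_Het ::
    "real ^ 'k ^ 'n \<Rightarrow> real ^ 'k ^ 'q \<Rightarrow> real ^ 'n \<Rightarrow> real ^ 'n \<Rightarrow> real ^ 'q ^ 'q" where
  "Omega_Het X R d y =
     R ** matrix_inv (transpose X ** X) ** transpose X
       ** diag_mat (\<chi> i. d $ i * (u_hat X y $ i)\<^sup>2)
       ** X ** matrix_inv (transpose X ** X) ** transpose R"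

definition T_Het ::
    "real ^ 'k ^ 'n \<Rightarrow> real ^ 'k ^ 'q \<Rightarrow> real ^ 'q \<Rightarrow> real ^ 'n \<Rightarrow> real ^ 'n \<Rightarrow> real" where
  "T_Het X R r d y =
     (if det (Omega_Het X R d y) \<noteq> 0
      then (R *v beta_hat X y - r) \<bullet>
        (matrix_inv (Omega_Het X R d y) *v (R *v beta_hat X y - r))
      else 0)"

text \<open>
  The matrix obtained from the transpose of \<open>X\<close> by deleting columns has a number of columns
  that depends on \<open>X\<close>, so it has no fixed type. Its product with \<open>R (X'X)\<^sup>-\<^sup>1\<close> is represented
  by the set of its columns, the images of the columns that are not deleted; the rank is the
  dimension of their span.
\<close>

definition assumption1 :: "real ^ 'k ^ 'n \<Rightarrow> real ^ 'k ^ 'q \<Rightarrow> bool" where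
  "assumption1 X R \<longleftrightarrow>
     dim {(R ** matrix_inv (transpose X ** X)) *v column i (transpose X) | i.
            axis i 1 \<notin> span (columns X)} = CARD('q)"

definition B_mat :: "real ^ 'k ^ 'n \<Rightarrow> real ^ 'k ^ 'q \<Rightarrow> real ^ 'n \<Rightarrow> real ^ 'n ^ 'q" where
  "B_mat X R y =
     R ** matrix_inv (transpose X ** X) ** transpose X ** diag_mat (u_hat X y)"

definition B_set :: "real ^ 'k ^ 'n \<Rightarrow> real ^ 'k ^ 'q \<Rightarrow> (real ^ 'n) set" where
  "B_set X R = {y. rank (B_mat X R y) < CARD('q)}"

definition C_star ::
    "real ^ 'k ^ 'n \<Rightarrow> real ^ 'k ^ 'q \<Rightarrow> (real ^ 'n \<Rightarrow> real) \<Rightarrow> real ^ 'n \<Rightarrow> real" where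
  "C_star X R T \<mu>0 = Max {T (\<mu>0 + axis i 1) | i. i \<in> I1 (M0_lin X R)}"

end

theory Submission
  imports Defs "HOL-Probability.Distributions"
begin

text \<open>
  For \<open>\<mu> \<in> M0\<close> both statistics, viewed as functions of \<open>w = y - \<mu>\<close>, are independent of \<open>\<mu>\<close> and
  invariant under \<open>w \<mapsto> c w\<close> with \<open>c \<noteq> 0\<close>. Covariance matrices in \<open>C_Het\<close> may put almost all of
  their variance on one coordinate \<open>i\<close>; then \<open>w\<close> concentrates along the \<open>i\<close>-th axis. On that axis,
  outside the origin, the statistic takes the single value it has at \<open>\<mu> + e\<^sub>i\<close>. If it is continuous there,
  every \<open>C\<close> below this value is exceeded on a double cone around the axis, whose probability tends to 1.
\<close>

section \<open>Inverses, Gram determinants and diagonal matrices\<close>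

text \<open>A one-sided inverse of a square matrix is two-sided and unique, so the choice operator
  behind \<open>matrix_inv\<close> has exactly one candidate.\<close>

lemma matrix_inv_eqI:
  fixes A B :: "real ^ 'n ^ 'n"
  assumes "A ** B = mat 1"
  shows "matrix_inv A = B"
proof -
  have "\<exists>B. A ** B = mat 1 \<and> B ** A = mat 1"
    using assms matrix_left_right_inverse by blast
  then have "A ** matrix_inv A = mat 1 \<and> matrix_inv A ** A = mat 1"
    unfolding matrix_inv_def by (rule someI_ex)
  then show ?thesis
    by (metis assms matrix_mul_assoc matrix_mul_lid matrix_mul_rid)
qed

lemma matrix_inv_nonsingular:
  fixes A :: "real ^ 'n ^ 'n"
  assumes "det A \<noteq> 0"
  shows "A ** matrix_inv A = mat 1" "matrix_inv A ** A = mat 1"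
proof -
  obtain B where "A ** B = mat 1" "B ** A = mat 1"
    using assms unfolding invertible_det_nz[symmetric] invertible_def by blast
  then show "A ** matrix_inv A = mat 1" "matrix_inv A ** A = mat 1"
    by (simp_all add: matrix_inv_eqI)
qed

text \<open>The form \<open>x \<bullet> ((A ** transpose A) *v x)\<close> is the squared norm of
  \<open>transpose A *v x\<close>. A kernel vector of the Gram matrix is thus one of
  \<open>transpose A\<close>, which is injective by full row rank.\<close>

lemma det_Gram_nonzero:
  fixes A :: "real ^ 'n ^ 'q"
  assumes "rank A = CARD('q)"
  shows "det (A ** transpose A) \<noteq> 0"
proof -
  have inj: "inj ((*v) (transpose A))"
    using assms full_rank_injective rank_transpose by metis
  have "x = 0" if "(A ** transpose A) *v x = 0" for x
  proof -
    have "(transpose A *v x) \<bullet> (transpose A *v x) = x \<bullet> ((A ** transpose A) *v x)"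
      by (metis dot_lmul_matrix matrix_vector_mul_assoc vector_transpose_matrix transpose_matrix_vector)
    then have "transpose A *v x = transpose A *v 0"
      using that by simp
    then show ?thesis using inj by (meson injD)
  qed
  then show ?thesis
    by (metis invertible_det_nz invertible_left_inverse matrix_left_invertible_ker)
qed

lemma transpose_matrix_inv:
  fixes A :: "real ^ 'n ^ 'n"
  assumes "det A \<noteq> 0"
  shows "transpose (matrix_inv A) = matrix_inv (transpose A)"
  by (rule sym, rule matrix_inv_eqI)
     (metis assms matrix_inv_nonsingular(2) matrix_transpose_mul transpose_mat)

lemma matrix_inv_scaleR:
  fixes A :: "real ^ 'n ^ 'n"
  assumes "det A \<noteq> 0" "c \<noteq> 0"
  shows "matrix_inv (c *\<^sub>R A) = (1 / c) *\<^sub>R matrix_inv A"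
  by (rule matrix_inv_eqI)
     (use assms in \<open>simp add: matrix_inv_nonsingular flip: matrix_scalar_ac scalar_matrix_assoc\<close>)

lemma det_scaleR:
  fixes A :: "real ^ 'n ^ 'n"
  shows "det (c *\<^sub>R A) = c ^ CARD('n) * det A"
  by (simp add: det_def prod.distrib sum_distrib_left algebra_simps)

lemma diag_mat_mult_vec: "diag_mat v *v x = (\<chi> i. v $ i * x $ i)"
proof -
  have "(\<Sum>j\<in>UNIV. (if i = j then v $ i else 0) * x $ j) = (\<Sum>j\<in>UNIV. if i = j then v $ i * x $ i else 0)" for i
    by (rule sum.cong) auto
  then show ?thesis
    by (simp add: diag_mat_def matrix_vector_mult_def vec_eq_iff)
qed

lemma diag_mat_mult: "diag_mat v ** diag_mat w = diag_mat (\<chi> i. v $ i * w $ i)"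
  by (simp add: matrix_eq diag_mat_mult_vec mult.assoc flip: matrix_vector_mul_assoc)

lemma transpose_diag_mat [simp]: "transpose (diag_mat v) = diag_mat v"
  by (auto simp add: diag_mat_def transpose_def vec_eq_iff)

lemma det_diag_mat: "det (diag_mat v) = (\<Prod>i\<in>UNIV. v $ i)"
  by (subst det_diagonal) (auto simp: diag_mat_def)

lemma matrix_inv_diag_mat:
  assumes "\<And>i. v $ i \<noteq> 0"
  shows "matrix_inv (diag_mat v) = diag_mat (\<chi> i. 1 / v $ i)"
  by (rule matrix_inv_eqI, unfold diag_mat_mult)
     (auto simp: assms vec_eq_iff mat_def diag_mat_def)

lemma scaleR_diag_mat: "c *\<^sub>R diag_mat v = diag_mat (c *\<^sub>R v)"
  by (auto simp: diag_mat_def vec_eq_iff)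

lemma linear_diag_mat: "linear diag_mat"
  by (rule linearI) (auto simp: diag_mat_def vec_eq_iff)

section \<open>The quadratic form common to both test statistics\<close>

text \<open>The value 0 at singular \<open>N\<close> follows the convention of \<open>T_Het\<close>;
  for \<open>T_uc\<close> it will match the value prescribed on the column space.\<close>

definition wald :: "real ^ 'q ^ 'q \<Rightarrow> real ^ 'q \<Rightarrow> real" where
  "wald N w = (if det N \<noteq> 0 then w \<bullet> (matrix_inv N *v w) else 0)"

text \<open>No case distinction is needed, since \<open>x / 0 = 0\<close>.\<close>

lemma wald_cramer:
  "wald N w = (\<Sum>k\<in>UNIV. w $ k * det (\<chi> i j. if j = k then w $ i else N $ i $ j)) / det N"
proof (cases "det N = 0")
  case False
  have "N *v (matrix_inv N *v w) = w"
    by (simp add: matrix_vector_mul_assoc matrix_inv_nonsingular[OF False])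
  then have *: "matrix_inv N *v w = (\<chi> k. det(\<chi> i j. if j=k then w$i else N$i$j) / det N)"
    using cramer[OF False] by blast
  show ?thesis
    using False unfolding wald_def * by (simp add: inner_vec_def sum_divide_distrib)
qed (simp add: wald_def)

text \<open>The two factors \<open>c\<close> from the vector cancel the factor
  \<open>1 / c\<^sup>2\<close> from the inverse, and scaling by a nonzero number does not change
  which branch of \<open>wald\<close> applies. This is the source of the scale invariance.\<close>

lemma wald_scaleR:
  assumes "c \<noteq> 0"
  shows "wald (c\<^sup>2 *\<^sub>R N) (c *\<^sub>R w) = wald N w"
proof -
  have "det (c\<^sup>2 *\<^sub>R N) = (c\<^sup>2) ^ CARD('a) * det N"
    by (rule det_scaleR)
  then show ?thesis
    using assms by (auto simp: wald_def matrix_inv_scaleR matrix_vector_mult_scaleR power2_eq_square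
        scaleR_matrix_vector_assoc[symmetric])
qed

lemma continuous_on_det:
  fixes A :: "'a::topological_space \<Rightarrow> real ^ 'n ^ 'n"
  assumes "\<And>i j. continuous_on S (\<lambda>y. A y $ i $ j)"
  shows "continuous_on S (\<lambda>y. det (A y))"
  unfolding det_def by (intro continuous_intros assms)

text \<open>By \<open>wald_cramer\<close> the form is a quotient of continuous functions with
  denominator \<open>det (N y)\<close>. Such a quotient is Borel on the whole space, zeros of the
  denominator included, and continuous wherever the denominator is nonzero.\<close>

lemma
  fixes N :: "'a::t2_space \<Rightarrow> real ^ 'q ^ 'q"
  assumes N: "continuous_on UNIV N" and w: "continuous_on UNIV w"
  shows borel_measurable_wald: "(\<lambda>y. wald (N y) (w y)) \<in> borel_measurable borel"
    and isCont_wald: "det (N x) \<noteq> 0 \<Longrightarrow> isCont (\<lambda>y. wald (N y) (w y)) x"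
proof -
  have 1: "continuous_on UNIV (\<lambda>y. det (N y))"
    by (intro continuous_on_det continuous_on_component N)
  have 2: "continuous_on UNIV (\<lambda>y. \<Sum>k\<in>UNIV. w y $ k * det (\<chi> i j. if j = k then w y $ i else N y $ i $ j))"
  proof (intro continuous_on_sum continuous_on_mult continuous_on_det)
    fix k i j
    show "continuous_on UNIV (\<lambda>y. (\<chi> i j. if j = k then w y $ i else N y $ i $ j) $ i $ j)"
      by (cases "j = k") (auto intro!: continuous_on_component N w)
  qed (intro continuous_on_component w)
  show "(\<lambda>y. wald (N y) (w y)) \<in> borel_measurable borel"
    unfolding wald_cramer
    by (intro borel_measurable_divide borel_measurable_continuous_onI 1 2)
  show "isCont (\<lambda>y. wald (N y) (w y)) x" if "det (N x) \<noteq> 0"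
    unfolding wald_cramer
    using 1 2 that by (auto simp: isCont_def continuous_on_def intro!: tendsto_divide)
qed

section \<open>Gaussian measures with diagonal covariance\<close>

lemma prod_Basis_cart: "(\<Prod>b\<in>(Basis :: (real ^ 'n) set). f b) = (\<Prod>i\<in>UNIV. f (axis i 1))"
proof -
  have "(Basis :: (real ^ 'n) set) = range (\<lambda>i. axis i 1)"
    by (auto simp: Basis_vec_def)
  moreover have "inj (\<lambda>i::'n. axis i (1::real))"
    by (auto simp: inj_def axis_eq_axis)
  ultimately show ?thesis
    using prod.reindex[of "\<lambda>i::'n. axis i (1::real)" UNIV f] by (simp only: o_def)
qed

lemma real_sqrt_prod: "sqrt (\<Prod>i\<in>A. f i) = (\<Prod>i\<in>A. sqrt (f i))"
  by (induction A rule: infinite_finite_induct) (simp_all add: real_sqrt_mult)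

text \<open>For a diagonal covariance the determinant is a product and the exponent a sum over the
  coordinates; the entries of \<open>s\<close> are the standard deviations.\<close>

lemma gaussian_diag_density:
  fixes \<mu> s :: "real ^ 'n"
  assumes s: "\<And>i. s $ i > 0"
  shows "gaussian \<mu> (diag_mat (\<chi> i. (s $ i)\<^sup>2)) =
    density lborel (\<lambda>y. \<Prod>i\<in>UNIV. ennreal (normal_density (\<mu> $ i) (s $ i) (y $ i)))"
proof -
  have 1: "sqrt ((2 * pi) ^ CARD('n) * (\<Prod>i\<in>UNIV. (s $ i)\<^sup>2)) = (\<Prod>i\<in>UNIV. sqrt (2 * pi * (s $ i)\<^sup>2))"
    by (simp only: real_sqrt_prod[symmetric] prod.distrib prod_constant power_mult_distrib)
  have 2: "(y - \<mu>) \<bullet> (matrix_inv (diag_mat (\<chi> i. (s $ i)\<^sup>2)) *v (y - \<mu>)) / 2 =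
      (\<Sum>i\<in>UNIV. (y $ i - \<mu> $ i)\<^sup>2 / (2 * (s $ i)\<^sup>2))" for y
    using s
    by (subst matrix_inv_diag_mat)
       (auto simp: less_imp_neq[symmetric] diag_mat_mult_vec inner_vec_def sum_divide_distrib
        power2_eq_square intro!: sum.cong)
  have 3: "exp (- ((y - \<mu>) \<bullet> (matrix_inv (diag_mat (\<chi> i. (s $ i)\<^sup>2)) *v (y - \<mu>))) / 2) =
      (\<Prod>i\<in>UNIV. exp (- (y $ i - \<mu> $ i)\<^sup>2 / (2 * (s $ i)\<^sup>2)))" for y
    unfolding exp_sum[OF finite, symmetric] minus_divide_left[symmetric] 2 sum_negf ..
  have "1 / sqrt ((2 * pi) ^ CARD('n) * det (diag_mat (\<chi> i. (s $ i)\<^sup>2))) *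
      exp (- ((y - \<mu>) \<bullet> (matrix_inv (diag_mat (\<chi> i. (s $ i)\<^sup>2)) *v (y - \<mu>))) / 2)
    = (\<Prod>i\<in>UNIV. normal_density (\<mu> $ i) (s $ i) (y $ i))" for y
    unfolding det_diag_mat vec_lambda_beta 1 3 normal_density_def prod.distrib prod_dividef prod.neutral_const ..
  then show ?thesis
    unfolding gaussian_def by (simp add: prod_ennreal)
qed

text \<open>Independence of the coordinates: density and indicator of the box both factor, so the
  integral splits by Fubini.\<close>

lemma emeasure_gaussian_diag_box:
  fixes \<mu> s :: "real ^ 'n"
  assumes s: "\<And>i. s $ i > 0" and A: "\<And>i. A i \<in> sets borel"
  shows "emeasure (gaussian \<mu> (diag_mat (\<chi> i. (s $ i)\<^sup>2))) {y. \<forall>i. y $ i \<in> A i} =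
    (\<Prod>i\<in>UNIV. emeasure (density lborel (normal_density (\<mu> $ i) (s $ i))) (A i))"
proof -
  have meas: "{y :: real ^ 'n. \<forall>i. y $ i \<in> A i} \<in> sets borel"
  proof -
    have "{y :: real ^ 'n. \<forall>i. y $ i \<in> A i} = (\<Inter>i. (\<lambda>y. y $ i) -` A i \<inter> space borel)"
      by auto
    also have "\<dots> \<in> sets borel"
      by (intro sets.finite_INT measurable_sets[OF _ A]) (auto intro!: borel_measurable_continuous_onI continuous_intros)
    finally show ?thesis .
  qed
  \<comment> \<open>\<open>nn_integral_lborel_prod\<close> expects factors indexed by basis vectors
    rather than by coordinates. The product over \<open>i\<close>, with factor 1 at every
    \<open>i\<close> not matching \<open>b\<close>, recovers the coordinate belonging to
    \<open>b\<close>.\<close>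
  let ?f = "\<lambda>(b :: real ^ 'n) x. \<Prod>i\<in>UNIV. if b = axis i 1
    then ennreal (normal_density (\<mu> $ i) (s $ i) x) * indicator (A i) x else 1"
  have f: "?f (axis i 1) x = ennreal (normal_density (\<mu> $ i) (s $ i) x) * indicator (A i) x" for i x
    by (simp add: axis_eq_axis)
  have ind: "indicator {y. \<forall>i. y $ i \<in> A i} y = (\<Prod>i\<in>UNIV. indicator (A i) (y $ i) :: ennreal)" for y
    by (auto simp: indicator_def prod_zero_iff)
  have "emeasure (gaussian \<mu> (diag_mat (\<chi> i. (s $ i)\<^sup>2))) {y. \<forall>i. y $ i \<in> A i} =
      (\<integral>\<^sup>+y. (\<Prod>i\<in>UNIV. ennreal (normal_density (\<mu> $ i) (s $ i) (y $ i))) *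
         indicator {y. \<forall>i. y $ i \<in> A i} y \<partial>lborel)"
    unfolding gaussian_diag_density[OF s]
    using meas by (subst emeasure_density) (auto intro!: borel_measurable_prod borel_measurable_continuous_onI continuous_intros
       measurable_compose[OF _ measurable_ennreal] simp: normal_density_def)
  also have "\<dots> = (\<integral>\<^sup>+y. (\<Prod>b\<in>Basis. ?f b (y \<bullet> b)) \<partial>lborel)"
    unfolding prod_Basis_cart f ind by (simp add: prod.distrib inner_axis)
  also have "\<dots> = (\<Prod>b\<in>Basis. \<integral>\<^sup>+x. ?f b x \<partial>lborel)"
    using A by (intro nn_integral_lborel_prod) (auto intro!: borel_measurable_prod)
  also have "\<dots> = (\<Prod>i\<in>UNIV. emeasure (density lborel (normal_density (\<mu> $ i) (s $ i))) (A i))"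
    unfolding prod_Basis_cart f using A by (simp add: emeasure_density)
  finally show ?thesis .
qed

lemma prob_space_gaussian_diag:
  fixes \<mu> s :: "real ^ 'n"
  assumes s: "\<And>i. s $ i > 0"
  shows "prob_space (gaussian \<mu> (diag_mat (\<chi> i. (s $ i)\<^sup>2)))"
proof
  have "emeasure (gaussian \<mu> (diag_mat (\<chi> i. (s $ i)\<^sup>2))) {y. \<forall>i. y $ i \<in> UNIV} = 1"
    using prob_space.emeasure_space_1[OF prob_space_normal_density[OF s]]
    by (subst emeasure_gaussian_diag_box[OF s]) simp_all
  then show "emeasure (gaussian \<mu> (diag_mat (\<chi> i. (s $ i)\<^sup>2)))
      (space (gaussian \<mu> (diag_mat (\<chi> i. (s $ i)\<^sup>2)))) = 1"
    by (simp add: gaussian_def)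
qed

lemma measure_gaussian_diag_box:
  fixes \<mu> s :: "real ^ 'n"
  assumes s: "\<And>i. s $ i > 0" and A: "\<And>i. A i \<in> sets borel"
  shows "measure (gaussian \<mu> (diag_mat (\<chi> i. (s $ i)\<^sup>2))) {y. \<forall>i. y $ i \<in> A i} =
    (\<Prod>i\<in>UNIV. measure (density lborel (normal_density (\<mu> $ i) (s $ i))) (A i))"
  using emeasure_gaussian_diag_box[OF s A]
    finite_measure.emeasure_eq_measure[OF prob_space.finite_measure[OF prob_space_normal_density[OF s]]]
    finite_measure.emeasure_eq_measure[OF prob_space.finite_measure[OF prob_space_gaussian_diag[OF s]]]
  by (simp add: prod_ennreal prod_nonneg)

section \<open>Deviation bounds for the one-dimensional normal law\<close>

text \<open>Chebyshev's inequality for the complement.\<close>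

lemma normal_density_concentration:
  assumes "s > 0" "a > 0"
  shows "measure (density lborel (normal_density m s)) {x. \<bar>x - m\<bar> < a} \<ge> 1 - s\<^sup>2 / a\<^sup>2"
proof -
  let ?N = "density lborel (normal_density m s)"
  interpret prob_space ?N by (rule prob_space_normal_density) fact
  have D: "distributed ?N lborel (\<lambda>x. x) (normal_density m s)"
    unfolding distributed_def by (auto simp: distr_id2)
  have "integrable ?N (\<lambda>x. (x - m)\<^sup>2)"
    using integrable_normal_moment[OF assms(1), of m 2] by (subst integrable_density) auto
  \<comment> \<open>Chebyshev's inequality requires a second moment about 0, whereas the known
    moments are central; the integrand is \<open>x\<^sup>2\<close> expanded about
    \<open>m\<close>.\<close>
  then have "integrable ?N (\<lambda>x. (x - m)\<^sup>2 + (2 * m * (x - m) + m\<^sup>2))"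
    using integrable_normal_moment[OF assms(1), of m 1]
    by (intro Bochner_Integration.integrable_add integrable_mult_right integrable_const)
       (auto simp: integrable_density)
  then have "integrable ?N (\<lambda>x. x\<^sup>2)"
    by (simp add: power2_eq_square algebra_simps)
  then have "prob {x \<in> space ?N. \<bar>x - m\<bar> \<ge> a} \<le> s\<^sup>2 / a\<^sup>2"
    using Chebyshev_inequality[of "\<lambda>x. x" a] normal_distributed_variance[OF assms(1) D]
      normal_distributed_expectation[OF assms(1) D] assms(2) by simp
  moreover have "prob {x. \<bar>x - m\<bar> < a} = 1 - prob {x \<in> space ?N. \<bar>x - m\<bar> \<ge> a}"
    by (subst prob_compl[symmetric]) (auto intro!: arg_cong[where f=prob])
  ultimately show ?thesis by simp
qed

text \<open>The density is at most \<open>1 / s\<close>, hence the complementary interval of length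
  \<open>2 * b\<close> has mass at most \<open>2 * b / s\<close>.\<close>

lemma normal_density_anticoncentration:
  assumes "s > 0" "b > 0"
  shows "measure (density lborel (normal_density m s)) {x. \<bar>x - m\<bar> > b} \<ge> 1 - 2 * b / s"
proof -
  let ?N = "density lborel (normal_density m s)"
  interpret prob_space ?N by (rule prob_space_normal_density) fact
  have le: "normal_density m s x \<le> 1 / s" for x
  proof -
    have "s \<le> sqrt (2 * pi) * s"
      using assms pi_gt3 by simp
    then have "1 / sqrt (2 * pi * s\<^sup>2) \<le> 1 / s"
      using assms by (auto simp: real_sqrt_mult intro!: divide_left_mono)
    moreover have "exp (- (x - m)\<^sup>2 / (2 * s\<^sup>2)) \<le> 1"
      by simp
    ultimately show ?thesis
      unfolding normal_density_def using assms by (smt (verit) mult_left_le divide_nonneg_nonneg real_sqrt_ge_zero zero_le_power2 pi_gt_zero mult_nonneg_nonneg)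
  qed
  have "emeasure ?N {m - b..m + b} \<le> (\<integral>\<^sup>+x. ennreal (1 / s) * indicator {m - b..m + b} x \<partial>lborel)"
    by (subst emeasure_density) (auto intro!: nn_integral_mono mult_right_mono ennreal_leI le)
  also have "\<dots> = ennreal (2 * b / s)"
    using assms by (simp add: nn_integral_cmult ennreal_mult[symmetric])
  finally have "prob {m - b..m + b} \<le> 2 * b / s"
    using assms by (simp add: emeasure_eq_measure)
  moreover have "prob {x. \<bar>x - m\<bar> > b} = 1 - prob {m - b..m + b}"
    by (subst prob_compl[symmetric]) (auto intro!: arg_cong[where f=prob])
  ultimately show ?thesis by simp
qed

section \<open>Concentration along a coordinate axis within \<open>C_Het\<close>\<close>

lemma prob_space_gaussian_C_Het:
  assumes "\<Sigma> \<in> C_Het" "v > 0"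
  shows "prob_space (gaussian \<mu> (v *\<^sub>R \<Sigma>))"
proof -
  obtain \<tau> where \<tau>: "\<Sigma> = diag_mat (\<chi> i. (\<tau> $ i)\<^sup>2)" "\<And>i. (\<tau> $ i)\<^sup>2 > 0"
    using assms(1) unfolding C_Het_def by blast
  \<comment> \<open>Membership in \<open>C_Het\<close> fixes only the squares of the entries of
    \<open>\<tau>\<close>; absolute values turn them into standard deviations.\<close>
  define s where "s = (\<chi> i. sqrt v * \<bar>\<tau> $ i\<bar>)"
  have "v *\<^sub>R \<Sigma> = diag_mat (\<chi> i. (s $ i)\<^sup>2)"
    using assms(2) by (simp add: \<tau>(1) scaleR_diag_mat vec_eq_iff s_def power_mult_distrib diag_mat_def)
  moreover have "s $ i > 0" for i
    using \<tau>(2)[of i] assms(2) by (simp add: s_def)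
  ultimately show ?thesis
    using prob_space_gaussian_diag by metis
qed

text \<open>As \<open>t\<close> tends to 0 the variances \<open>\<tau>\<^sub>j\<^sup>2 = t\<^sup>4\<close>, \<open>j \<noteq> i\<close>, concentrate the whole variance
  budget on coordinate \<open>i\<close>, while the box of half-width \<open>\<delta> t\<close> in the other coordinates still
  captures almost all of the mass.\<close>

lemma C_Het_concentration:
  fixes \<mu> :: "real ^ 'n"
  assumes "\<delta> > 0" "v > 0"
  obtains \<Sigma> where "\<And>t. 0 < t \<Longrightarrow> t < 1 / CARD('n) \<Longrightarrow> \<Sigma> t \<in> C_Het"
    and "((\<lambda>t. measure (gaussian \<mu> (v *\<^sub>R \<Sigma> t))
      {y. \<bar>y $ i - \<mu> $ i\<bar> > t \<and> (\<forall>j. j \<noteq> i \<longrightarrow> \<bar>y $ j - \<mu> $ j\<bar> < \<delta> * t)}) \<longlongrightarrow> 1) (at_right 0)"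
proof -
  let ?n = "real CARD('n)"
  \<comment> \<open>Trace 1 leaves the variance \<open>1 - (?n - 1) * t ^ 4\<close> for coordinate
    \<open>i\<close>. It is positive for \<open>t < 1 / ?n\<close> by the crude estimate
    \<open>(?n - 1) * t ^ 4 \<le> ?n * t\<close>.\<close>
  define \<tau> :: "real \<Rightarrow> real ^ 'n" where
    "\<tau> t = (\<chi> j. if j = i then sqrt (1 - (?n - 1) * t ^ 4) else t\<^sup>2)" for t
  define \<Sigma> where "\<Sigma> t = diag_mat (\<chi> j. (\<tau> t $ j)\<^sup>2)" for t
  define A where "A t j = (if j = i then {x. \<bar>x - \<mu> $ j\<bar> > t} else {x. \<bar>x - \<mu> $ j\<bar> < \<delta> * t})" for t j
  have n: "?n \<ge> 1"
    by (simp add: Suc_leI)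
  have small: "(?n - 1) * t ^ 4 < 1" if "0 < t" "t < 1 / ?n" for t
  proof -
    have "?n * t < 1"
      using that n by (simp add: field_simps)
    moreover have "t \<le> ?n * t"
      using that n mult_right_mono[of 1 ?n t] by simp
    ultimately have "t \<le> 1" "?n * t < 1"
      by simp_all
    moreover have "t ^ 4 \<le> t"
      using power_decreasing[of 1 4 t] that \<open>t \<le> 1\<close> by simp
    moreover have "(?n - 1) * t ^ 4 \<le> ?n * t"
      using n that \<open>t ^ 4 \<le> t\<close> by (intro mult_mono) auto
    ultimately show ?thesis by linarith
  qed
  have pos: "\<tau> t $ j > 0" if "0 < t" "t < 1 / ?n" for t j
    using small[OF that] that by (simp add: \<tau>_def)
  have "\<Sigma> t \<in> C_Het" if t: "0 < t" "t < 1 / ?n" for t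
  proof -
    have "(\<Sum>j\<in>UNIV. (\<tau> t $ j)\<^sup>2) = (\<tau> t $ i)\<^sup>2 + (\<Sum>j\<in>UNIV - {i}. (\<tau> t $ j)\<^sup>2)"
      by (subst sum.remove[of _ i]) auto
    also have "(\<Sum>j\<in>UNIV - {i}. (\<tau> t $ j)\<^sup>2) = (\<Sum>j\<in>UNIV - {i}. t ^ 4)"
      by (intro sum.cong) (auto simp: \<tau>_def)
    also have "\<dots> = (?n - 1) * t ^ 4"
      using n by (simp add: card_Diff_singleton of_nat_diff)
    finally have "(\<Sum>j\<in>UNIV. (\<tau> t $ j)\<^sup>2) = 1"
      using small[OF t] by (simp add: \<tau>_def)
    then show ?thesis
      using pos[OF t] unfolding C_Het_def \<Sigma>_def by (auto intro!: exI[of _ "\<tau> t"] simp: less_imp_neq[symmetric])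
  qed
  moreover have "((\<lambda>t. measure (gaussian \<mu> (v *\<^sub>R \<Sigma> t))
      {y. \<bar>y $ i - \<mu> $ i\<bar> > t \<and> (\<forall>j. j \<noteq> i \<longrightarrow> \<bar>y $ j - \<mu> $ j\<bar> < \<delta> * t)}) \<longlongrightarrow> 1) (at_right 0)"
  proof -
    let ?s = "\<lambda>t. sqrt v *\<^sub>R \<tau> t"
    let ?m = "\<lambda>t j. measure (density lborel (normal_density (\<mu> $ j) (?s t $ j))) (A t j)"
    have ev: "eventually (\<lambda>t. 0 < t \<and> t < 1 / ?n) (at_right 0)"
      using n by (intro eventually_conj eventually_at_right_less eventually_at_right_real[THEN eventually_mono, of 0 "1 / ?n"]) auto
    have spos: "?s t $ j > 0" if "0 < t" "t < 1 / ?n" for t j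
      using pos[OF that] assms by simp
    have meas: "A t j \<in> sets borel" for t j
      by (auto simp: A_def)
    have eq: "measure (gaussian \<mu> (v *\<^sub>R \<Sigma> t))
      {y. \<bar>y $ i - \<mu> $ i\<bar> > t \<and> (\<forall>j. j \<noteq> i \<longrightarrow> \<bar>y $ j - \<mu> $ j\<bar> < \<delta> * t)} = (\<Prod>j\<in>UNIV. ?m t j)"
      if t: "0 < t" "t < 1 / ?n" for t
    proof -
      have 1: "v *\<^sub>R \<Sigma> t = diag_mat (\<chi> j. (?s t $ j)\<^sup>2)"
        using assms by (simp add: \<Sigma>_def scaleR_diag_mat vec_eq_iff power_mult_distrib diag_mat_def)
      have 2: "{y. \<bar>y $ i - \<mu> $ i\<bar> > t \<and> (\<forall>j. j \<noteq> i \<longrightarrow> \<bar>y $ j - \<mu> $ j\<bar> < \<delta> * t)} = {y. \<forall>j. y $ j \<in> A t j}"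
        by (auto simp: A_def)
      show ?thesis
        unfolding 1 2 by (rule measure_gaussian_diag_box[OF spos[OF t] meas])
    qed
    have lim: "((\<lambda>t. ?m t j) \<longlongrightarrow> 1) (at_right 0)" for j
    proof (rule tendsto_sandwich)
      \<comment> \<open>At \<open>i\<close> the standard deviation tends to \<open>sqrt v\<close>,
        so leaving an interval of half-width \<open>t\<close> has probability tending to 1.
        Elsewhere the variance is \<open>v * t ^ 4\<close>, and Chebyshev's error against half-width
        \<open>\<delta> * t\<close> is \<open>v * t\<^sup>2 / \<delta>\<^sup>2\<close>, which
        vanishes because the variance decays faster than the squared width.\<close>
      let ?l = "\<lambda>t. if j = i then 1 - 2 * t / (?s t $ j) else 1 - (?s t $ j)\<^sup>2 / (\<delta> * t)\<^sup>2"
      show "eventually (\<lambda>t. ?l t \<le> ?m t j) (at_right 0)"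
        using ev
      proof eventually_elim
        case (elim t)
        then have "?s t $ j > 0"
          using spos by blast
        then show ?case
          using elim assms normal_density_anticoncentration[of "?s t $ j" t "\<mu> $ j"]
            normal_density_concentration[of "?s t $ j" "\<delta> * t" "\<mu> $ j"]
          by (auto simp: A_def)
      qed
      show "eventually (\<lambda>t. ?m t j \<le> 1) (at_right 0)"
        using ev
      proof eventually_elim
        case (elim t)
        then show ?case
          using prob_space.prob_le_1[OF prob_space_normal_density[OF spos]] by blast
      qed
      show "(?l \<longlongrightarrow> 1) (at_right 0)"
      proof (cases "j = i")
        case True
        have "((\<lambda>t. 1 - 2 * t / (sqrt v * sqrt (1 - (?n - 1) * t ^ 4))) \<longlongrightarrow>
            1 - 2 * 0 / (sqrt v * sqrt (1 - (?n - 1) * 0 ^ 4))) (at_right 0)"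
          using assms by (intro tendsto_intros) auto
        then show ?thesis
          using True by (simp add: \<tau>_def)
      next
        case False
        have "((\<lambda>t. 1 - v * t\<^sup>2 / \<delta>\<^sup>2) \<longlongrightarrow> 1 - v * 0\<^sup>2 / \<delta>\<^sup>2) (at_right 0)"
          using assms by (intro tendsto_intros) auto
        moreover have "eventually (\<lambda>t. 1 - v * t\<^sup>2 / \<delta>\<^sup>2 = ?l t) (at_right 0)"
          using ev
          by eventually_elim (use False assms in \<open>auto simp: \<tau>_def power_mult_distrib field_simps power2_eq_square\<close>)
        ultimately show ?thesis
          using tendsto_cong by (simp add: tendsto_cong)
      qed
    qed simp
    have "((\<lambda>t. \<Prod>j\<in>UNIV. ?m t j) \<longlongrightarrow> (\<Prod>j\<in>(UNIV :: 'n set). 1)) (at_right 0)"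
      by (intro tendsto_prod lim)
    moreover have "eventually (\<lambda>t. (\<Prod>j\<in>UNIV. ?m t j) = measure (gaussian \<mu> (v *\<^sub>R \<Sigma> t))
      {y. \<bar>y $ i - \<mu> $ i\<bar> > t \<and> (\<forall>j. j \<noteq> i \<longrightarrow> \<bar>y $ j - \<mu> $ j\<bar> < \<delta> * t)}) (at_right 0)"
      using ev by eventually_elim (use eq in auto)
    ultimately show ?thesis
      by (simp add: tendsto_cong)
  qed
  ultimately show thesis by (rule that)
qed

text \<open>Continuity gives a ball around \<open>\<mu> + axis i 1\<close> on which \<open>T\<close>
  exceeds \<open>C\<close>, and \<open>hom\<close> spreads it to a double cone. For each small
  \<open>t\<close> the cone contains the set from \<open>C_Het_concentration\<close>, whose mass
  tends to 1.\<close>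

lemma SUP_C_Het_eq_1:
  fixes T :: "real ^ 'n \<Rightarrow> real"
  assumes T: "T \<in> borel_measurable borel"
    and hom: "\<And>c w. c \<noteq> 0 \<Longrightarrow> T (\<mu> + c *\<^sub>R w) = T (\<mu> + w)"
    and cont: "isCont T (\<mu> + axis i 1)" and C: "T (\<mu> + axis i 1) > C" and v: "v > 0"
  shows "(SUP \<Sigma>\<in>C_Het. measure (gaussian \<mu> (v *\<^sub>R \<Sigma>)) {y. T y \<ge> C}) = 1"
proof -
  have "eventually (\<lambda>y. T y > C) (nhds (\<mu> + axis i 1))"
    using cont C order_tendstoD(1) unfolding isCont_def tendsto_at_iff_tendsto_nhds by blast
  then obtain e where e: "e > 0" "\<And>y. dist y (\<mu> + axis i 1) < e \<Longrightarrow> T y > C"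
    by (auto simp: eventually_nhds_metric)
  \<comment> \<open>The distance is bounded by the sum of the coordinate deviations, so each of the
    \<open>CARD('n)\<close> coordinates may use an equal share of \<open>e\<close>.\<close>
  define \<delta> where "\<delta> = e / CARD('n)"
  have \<delta>: "\<delta> > 0"
    using e(1) by (simp add: \<delta>_def)
  have cone: "T y \<ge> C" if t: "0 < t" and yi: "\<bar>y $ i - \<mu> $ i\<bar> > t"
    and yj: "\<And>j. j \<noteq> i \<Longrightarrow> \<bar>y $ j - \<mu> $ j\<bar> < \<delta> * t" for y t
  proof -
    \<comment> \<open>Dividing \<open>y - \<mu>\<close> by its \<open>i\<close>-th coordinate makes
      that coordinate 1 and, as \<open>\<bar>c\<bar>\<close> exceeds \<open>t\<close>, brings the
      others below \<open>\<delta>\<close>. The sign of \<open>c\<close> is free, which yields both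
      halves of the cone.\<close>
    define c where "c = y $ i - \<mu> $ i"
    have c: "c \<noteq> 0" "\<bar>c\<bar> > t"
      using t yi by (auto simp: c_def)
    let ?w = "(1 / c) *\<^sub>R (y - \<mu>)"
    have le: "\<bar>(?w - axis i 1) $ j\<bar> < \<delta>" for j
    proof (cases "j = i")
      case True
      then show ?thesis using c \<delta> by (simp add: c_def axis_def)
    next
      case False
      have "\<bar>y $ j - \<mu> $ j\<bar> < \<delta> * \<bar>c\<bar>"
        using yj[OF False] c(2) \<delta> by (smt (verit) mult_strict_left_mono)
      then show ?thesis
        using False c by (simp add: axis_def abs_divide pos_divide_less_eq)
    qed
    have "norm (?w - axis i 1) \<le> (\<Sum>j\<in>UNIV. \<bar>(?w - axis i 1) $ j\<bar>)"
      by (rule norm_le_l1_cart)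
    also have "\<dots> < (\<Sum>j\<in>(UNIV :: 'n set). \<delta>)"
      by (intro sum_strict_mono le) auto
    also have "\<dots> = e"
      by (simp add: \<delta>_def)
    finally have "T (\<mu> + ?w) > C"
      by (intro e(2)) (simp add: dist_norm)
    moreover have "T y = T (\<mu> + ?w)"
      using hom[OF c(1), of ?w] c(1) by simp
    ultimately show ?thesis by simp
  qed
  obtain \<Sigma> where \<Sigma>: "\<And>t. 0 < t \<Longrightarrow> t < 1 / CARD('n) \<Longrightarrow> \<Sigma> t \<in> C_Het"
    and lim: "((\<lambda>t. measure (gaussian \<mu> (v *\<^sub>R \<Sigma> t))
      {y. \<bar>y $ i - \<mu> $ i\<bar> > t \<and> (\<forall>j. j \<noteq> i \<longrightarrow> \<bar>y $ j - \<mu> $ j\<bar> < \<delta> * t)}) \<longlongrightarrow> 1) (at_right 0)"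
    using C_Het_concentration[OF \<delta> v] by blast
  let ?S = "SUP \<Sigma>\<in>C_Het. measure (gaussian \<mu> (v *\<^sub>R \<Sigma>)) {y. T y \<ge> C}"
  \<comment> \<open>This bound also supplies the boundedness needed to compare single values with a
    real supremum.\<close>
  have le1: "measure (gaussian \<mu> (v *\<^sub>R \<Sigma>)) {y. T y \<ge> C} \<le> 1" if "\<Sigma> \<in> C_Het" for \<Sigma>
    using prob_space.prob_le_1[OF prob_space_gaussian_C_Het[OF that v]] .
  have meas: "{y. T y \<ge> C} \<in> sets (gaussian \<mu> (v *\<^sub>R \<Sigma>))" for \<Sigma>
    using borel_measurable_le[OF borel_measurable_const T, of C] by (simp add: gaussian_def)
  have ev: "eventually (\<lambda>t. 0 < t \<and> t < 1 / real CARD('n)) (at_right 0)"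
    by (intro eventually_conj eventually_at_right_less eventually_at_right_real[THEN eventually_mono, of 0 "1 / real CARD('n)"]) auto
  have "1 \<le> ?S"
  proof (rule tendsto_upperbound[OF lim])
    show "eventually (\<lambda>t. measure (gaussian \<mu> (v *\<^sub>R \<Sigma> t))
      {y. \<bar>y $ i - \<mu> $ i\<bar> > t \<and> (\<forall>j. j \<noteq> i \<longrightarrow> \<bar>y $ j - \<mu> $ j\<bar> < \<delta> * t)} \<le> ?S) (at_right 0)"
      using ev
    proof eventually_elim
      case (elim t)
      then have \<Sigma>t: "\<Sigma> t \<in> C_Het" using \<Sigma> by blast
      have "measure (gaussian \<mu> (v *\<^sub>R \<Sigma> t))
        {y. \<bar>y $ i - \<mu> $ i\<bar> > t \<and> (\<forall>j. j \<noteq> i \<longrightarrow> \<bar>y $ j - \<mu> $ j\<bar> < \<delta> * t)}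
        \<le> measure (gaussian \<mu> (v *\<^sub>R \<Sigma> t)) {y. T y \<ge> C}"
        using elim cone
        by (intro finite_measure.finite_measure_mono meas
            prob_space.finite_measure[OF prob_space_gaussian_C_Het[OF \<Sigma>t v]]) blast
      also have "\<dots> \<le> ?S"
        using \<Sigma>t le1 by (intro cSUP_upper bdd_aboveI2)
      finally show ?case .
    qed
  qed simp
  moreover have "?S \<le> 1"
  proof (rule cSUP_least)
    \<comment> \<open>A least upper bound argument over the reals needs a nonempty index set; any
      admissible \<open>t\<close> provides an element of \<open>C_Het\<close>.\<close>
    have "\<exists>t. 0 < t \<and> t < 1 / real CARD('n)"
      by (rule dense) simp
    then show "C_Het \<noteq> ({} :: (real ^ 'n ^ 'n) set)"
      using \<Sigma> by blast
  qed (rule le1)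
  ultimately show ?thesis by (rule antisym[rotated])
qed

section \<open>From invariance and continuity to a bound on critical values\<close>

lemma span_columns: "span (columns X) = range ((*v) X)" for X :: "real ^ 'k ^ 'n"
proof
  have "columns X \<subseteq> range ((*v) X)"
    by (auto simp: columns_def simp flip: matrix_vector_mult_basis)
  then show "span (columns X) \<subseteq> range ((*v) X)"
    by (intro span_minimal linear_subspace_image) auto
qed (auto intro: matrix_vector_mult_in_columnspace)

text \<open>If every basis vector were in \<open>M0_lin X R\<close>, then \<open>X\<close> would be
  onto and have rank \<open>CARD('n)\<close>, more than its number of columns. Nonemptiness ensures
  that the maximum in \<open>C_star\<close> is attained.\<close>

lemma I1_nonempty:
  fixes X :: "real ^ 'k ^ 'n"
  assumes "CARD('k) < CARD('n)"
  shows "I1 (M0_lin X R) \<noteq> {}"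
proof
  assume "I1 (M0_lin X R) = {}"
  then have "axis i 1 \<in> range ((*v) X)" for i
    by (auto simp: I1_def I0_def M0_lin_def)
  then have "Basis \<subseteq> range ((*v) X)"
    by (auto simp: Basis_vec_def)
  then have "span Basis \<subseteq> range ((*v) X)"
    by (intro span_minimal linear_subspace_image) auto
  then have "range ((*v) X) = UNIV"
    by auto
  then have "rank X = CARD('n)"
    by (simp add: rank_dim_range)
  then show False
    using rank_bound[of X] assms by simp
qed

text \<open>The argument shared by both statistics. Hypothesis \<open>inv\<close> combines
  independence of the base point in \<open>M0\<close> (take \<open>c = 1\<close>) with scale
  invariance (take equal base points).\<close>

lemma size_lower_bound:
  fixes X :: "real ^ 'k ^ 'n" and R :: "real ^ 'k ^ 'q" and T :: "real ^ 'n \<Rightarrow> real"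
  assumes "CARD('k) < CARD('n)"
    and T: "T \<in> borel_measurable borel"
    and inv: "\<And>\<mu> \<nu> c w. \<mu> \<in> M0 X R r \<Longrightarrow> \<nu> \<in> M0 X R r \<Longrightarrow> c \<noteq> 0 \<Longrightarrow> T (\<mu> + c *\<^sub>R w) = T (\<nu> + w)"
    and cont: "\<And>\<mu> i. \<mu> \<in> M0 X R r \<Longrightarrow> i \<in> I1 (M0_lin X R) \<Longrightarrow> isCont T (\<mu> + axis i 1)"
  shows "(\<forall>\<mu>\<in>M0 X R r. \<forall>\<nu>\<in>M0 X R r. C_star X R T \<mu> = C_star X R T \<nu>) \<and>
       (\<forall>\<mu>\<in>M0 X R r.
          (\<forall>\<alpha> C\<alpha> :: real. 0 < \<alpha> \<and> \<alpha> < 1 \<and>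
             (SUP \<mu>0\<in>M0 X R r. SUP \<sigma>2\<in>{0<..}. SUP \<Sigma>\<in>C_Het.
                measure (gaussian \<mu>0 (\<sigma>2 *\<^sub>R \<Sigma>)) {y. T y \<ge> C\<alpha>}) \<le> \<alpha>
             \<longrightarrow> C\<alpha> \<ge> C_star X R T \<mu>) \<and>
          (\<forall>C < C_star X R T \<mu>. \<forall>\<mu>0\<in>M0 X R r. \<forall>\<sigma>2>0.
             (SUP \<Sigma>\<in>C_Het.
                measure (gaussian \<mu>0 (\<sigma>2 *\<^sub>R \<Sigma>)) {y. T y \<ge> C}) = 1))"
proof -
  have C_star_image: "C_star X R T \<mu> = Max ((\<lambda>i. T (\<mu> + axis i 1)) ` I1 (M0_lin X R))" for \<mu>
    unfolding C_star_def by (simp add: setcompr_eq_image)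
  have shift: "T (\<mu> + w) = T (\<nu> + w)" if "\<mu> \<in> M0 X R r" "\<nu> \<in> M0 X R r" for \<mu> \<nu> w
    using inv[OF that, of 1] by simp
  have indep: "C_star X R T \<mu> = C_star X R T \<nu>" if "\<mu> \<in> M0 X R r" "\<nu> \<in> M0 X R r" for \<mu> \<nu>
    unfolding C_star_image using shift[OF that] by simp
  have one: "(SUP \<Sigma>\<in>C_Het. measure (gaussian \<mu>0 (v *\<^sub>R \<Sigma>)) {y. T y \<ge> C}) = 1"
    if C: "C < C_star X R T \<mu>" and \<mu>: "\<mu> \<in> M0 X R r" "\<mu>0 \<in> M0 X R r" and v: "v > 0" for C \<mu> \<mu>0 v
  proof -
    have "C_star X R T \<mu>0 \<in> (\<lambda>i. T (\<mu>0 + axis i 1)) ` I1 (M0_lin X R)"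
      unfolding C_star_image using I1_nonempty[OF assms(1)] by (intro Max_in) auto
    then obtain i where i: "i \<in> I1 (M0_lin X R)" "T (\<mu>0 + axis i 1) > C"
      using C indep[OF \<mu>] by auto
    show ?thesis
      by (rule SUP_C_Het_eq_1[OF T inv[OF \<mu>(2) \<mu>(2)] cont[OF \<mu>(2) i(1)] i(2) v])
  qed
  have "C\<alpha> \<ge> C_star X R T \<mu>"
    if \<mu>: "\<mu> \<in> M0 X R r" and "\<alpha> < 1"
      and le: "(SUP \<mu>0\<in>M0 X R r. SUP \<sigma>2\<in>{0<..}. SUP \<Sigma>\<in>C_Het.
        measure (gaussian \<mu>0 (\<sigma>2 *\<^sub>R \<Sigma>)) {y. T y \<ge> C\<alpha>}) \<le> \<alpha>" for \<mu> \<alpha> C\<alpha>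
  proof (rule ccontr)
    assume "\<not> C\<alpha> \<ge> C_star X R T \<mu>"
    then have "(SUP \<Sigma>\<in>C_Het. measure (gaussian \<mu>0 (\<sigma>2 *\<^sub>R \<Sigma>)) {y. T y \<ge> C\<alpha>}) = 1"
      if "\<mu>0 \<in> M0 X R r" "\<sigma>2 \<in> {0<..}" for \<mu>0 \<sigma>2
      using one[OF _ \<mu> that(1)] that(2) by simp
    \<comment> \<open>The inner supremum becomes the constant 1 before the outer two are evaluated,
      so these are suprema of a constant over nonempty sets; \<open>\<mu>\<close> witnesses that
      \<open>M0 X R r\<close> is nonempty.\<close>
    then have "(SUP \<mu>0\<in>M0 X R r. SUP \<sigma>2\<in>{0<..}. SUP \<Sigma>\<in>C_Het.
        measure (gaussian \<mu>0 (\<sigma>2 *\<^sub>R \<Sigma>)) {y. T y \<ge> C\<alpha>}) =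
      (SUP \<mu>0\<in>M0 X R r. SUP \<sigma>2\<in>{0::real<..}. 1 :: real)"
      by (intro SUP_cong refl) auto
    also have "\<dots> = 1"
      using \<mu> by (subst cSUP_const, simp)+ auto
    finally show False
      using le \<open>\<alpha> < 1\<close> by simp
  qed
  then show ?thesis
    using indep one by blast
qed

section \<open>Least squares under shifts by \<open>M0\<close> and rescaling\<close>

lemma det_Gram_columns_nonzero:
  fixes X :: "real ^ 'k ^ 'n"
  assumes "rank X = CARD('k)"
  shows "det (transpose X ** X) \<noteq> 0"
  using det_Gram_nonzero[of "transpose X"] assms by (simp add: rank_transpose)

lemma beta_hat_eq: "beta_hat X y = (matrix_inv (transpose X ** X) ** transpose X) *v y"
  by (simp only: beta_hat_def matrix_vector_mul_assoc)

lemma beta_hat_regression: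
  fixes X :: "real ^ 'k ^ 'n"
  assumes "rank X = CARD('k)"
  shows "beta_hat X (X *v \<beta>) = \<beta>"
proof -
  have "beta_hat X (X *v \<beta>) = (matrix_inv (transpose X ** X) ** (transpose X ** X)) *v \<beta>"
    by (simp only: beta_hat_def matrix_vector_mul_assoc matrix_mul_assoc)
  then show ?thesis
    by (simp add: matrix_inv_nonsingular[OF det_Gram_columns_nonzero[OF assms]])
qed

lemma linear_u_hat: "linear (u_hat X)"
  unfolding u_hat_def beta_hat_eq
  by (intro linear_compose_sub linear_id[unfolded id_def] linear_compose[unfolded o_def, OF matrix_vector_mul_linear matrix_vector_mul_linear])

lemma u_hat_eq_0_iff:
  fixes X :: "real ^ 'k ^ 'n"
  assumes "rank X = CARD('k)"
  shows "u_hat X y = 0 \<longleftrightarrow> y \<in> span (columns X)"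
  by (auto simp: u_hat_def span_columns beta_hat_regression[OF assms])

text \<open>Points of \<open>M0\<close> lie in the column space, where residuals vanish; the rest is
  linearity.\<close>

lemma u_hat_affine:
  fixes X :: "real ^ 'k ^ 'n"
  assumes "rank X = CARD('k)" "\<mu> \<in> M0 X R r"
  shows "u_hat X (\<mu> + c *\<^sub>R w) = c *\<^sub>R u_hat X w"
proof -
  have "u_hat X \<mu> = 0"
    using assms(2) by (auto simp: u_hat_eq_0_iff[OF assms(1)] span_columns M0_def)
  then show ?thesis
    by (simp add: linear_add[OF linear_u_hat] linear_scale[OF linear_u_hat])
qed

text \<open>Write \<open>\<mu> = X *v \<beta>\<close>. The estimator recovers \<open>\<beta>\<close>
  exactly, and \<open>R *v \<beta>\<close> cancels \<open>r\<close>.\<close>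

lemma restriction_affine:
  fixes X :: "real ^ 'k ^ 'n"
  assumes "rank X = CARD('k)" "\<mu> \<in> M0 X R r"
  shows "R *v beta_hat X (\<mu> + c *\<^sub>R w) - r = c *\<^sub>R (R *v beta_hat X w)"
proof -
  obtain \<beta> where \<beta>: "\<mu> = X *v \<beta>" "R *v \<beta> = r"
    using assms(2) by (auto simp: M0_def)
  have "beta_hat X (\<mu> + c *\<^sub>R w) = \<beta> + c *\<^sub>R beta_hat X w"
    using beta_hat_regression[OF assms(1), of \<beta>] unfolding \<beta> beta_hat_eq
    by (simp add: matrix_vector_right_distrib matrix_vector_mult_scaleR)
  then show ?thesis
    by (simp add: matrix_vector_right_distrib matrix_vector_mult_scaleR \<beta>)
qed

lemma continuous_on_u_hat: "continuous_on S (u_hat X)"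
  using linear_u_hat linear_continuous_on linear_conv_bounded_linear by blast

lemma continuous_on_restriction: "continuous_on S (\<lambda>y. R *v beta_hat X y - r)"
  unfolding beta_hat_eq
  by (intro continuous_intros linear_continuous_on_compose[OF _ matrix_vector_mul_linear])

text \<open>Relative to a base point in \<open>M0\<close>, the matrix \<open>N\<close> is
  homogeneous of degree 2 and the restriction vector of degree 1, so \<open>wald_scaleR\<close>
  gives the required invariance. What remains to be checked for each statistic is nonsingularity of
  \<open>N\<close> at the relevant basis vectors.\<close>

lemma wald_size_lower_bound:
  fixes X :: "real ^ 'k ^ 'n" and R :: "real ^ 'k ^ 'q"
  assumes "CARD('k) < CARD('n)" and rank_X: "rank X = CARD('k)"
    and T: "T = (\<lambda>y. wald (N y) (R *v beta_hat X y - r))"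
    and N: "continuous_on UNIV N"
    and aff: "\<And>\<mu> c w. \<mu> \<in> M0 X R r \<Longrightarrow> N (\<mu> + c *\<^sub>R w) = c\<^sup>2 *\<^sub>R N w"
    and det: "\<And>i. i \<in> I1 (M0_lin X R) \<Longrightarrow> det (N (axis i 1)) \<noteq> 0"
  shows "(\<forall>\<mu>\<in>M0 X R r. \<forall>\<nu>\<in>M0 X R r. C_star X R T \<mu> = C_star X R T \<nu>) \<and>
       (\<forall>\<mu>\<in>M0 X R r.
          (\<forall>\<alpha> C\<alpha> :: real. 0 < \<alpha> \<and> \<alpha> < 1 \<and>
             (SUP \<mu>0\<in>M0 X R r. SUP \<sigma>2\<in>{0<..}. SUP \<Sigma>\<in>C_Het.
                measure (gaussian \<mu>0 (\<sigma>2 *\<^sub>R \<Sigma>)) {y. T y \<ge> C\<alpha>}) \<le> \<alpha>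
             \<longrightarrow> C\<alpha> \<ge> C_star X R T \<mu>) \<and>
          (\<forall>C < C_star X R T \<mu>. \<forall>\<mu>0\<in>M0 X R r. \<forall>\<sigma>2>0.
             (SUP \<Sigma>\<in>C_Het.
                measure (gaussian \<mu>0 (\<sigma>2 *\<^sub>R \<Sigma>)) {y. T y \<ge> C}) = 1))"
proof (rule size_lower_bound[OF assms(1)])
  show "T \<in> borel_measurable borel"
    unfolding T by (intro borel_measurable_wald N continuous_on_restriction)
  have *: "T (\<mu> + c *\<^sub>R w) = wald (N w) (R *v beta_hat X w)" if "\<mu> \<in> M0 X R r" "c \<noteq> 0" for \<mu> c w
    using that by (simp add: T aff restriction_affine[OF rank_X] wald_scaleR)
  show "T (\<mu> + c *\<^sub>R w) = T (\<nu> + w)" if "\<mu> \<in> M0 X R r" "\<nu> \<in> M0 X R r" "c \<noteq> 0" for \<mu> \<nu> c w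
    using *[OF that(1,3), of w] *[OF that(2), of 1 w] by simp
  show "isCont T (\<mu> + axis i 1)" if "\<mu> \<in> M0 X R r" "i \<in> I1 (M0_lin X R)" for \<mu> i
    \<comment> \<open>With \<open>c = 1\<close>, \<open>aff\<close> carries nonsingularity from
      \<open>axis i 1\<close> over to \<open>\<mu> + axis i 1\<close>.\<close>
    unfolding T using aff[OF that(1), of 1] det[OF that(2)]
    by (intro isCont_wald N continuous_on_restriction) simp
qed

section \<open>Nonsingularity and homogeneity of the two covariance estimators\<close>

text \<open>The matrix is the Gram matrix of \<open>?P\<close>. Since \<open>?P ** X\<close> acts as
  \<open>R\<close>, which is onto, \<open>?P\<close> is onto as well and has full row rank.\<close>

lemma det_restriction_cov:
  fixes X :: "real ^ 'k ^ 'n" and R :: "real ^ 'k ^ 'q"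
  assumes rank_X: "rank X = CARD('k)" and rank_R: "rank R = CARD('q)"
  shows "det (R ** matrix_inv (transpose X ** X) ** transpose R) \<noteq> 0"
proof -
  let ?S = "transpose X ** X"
  let ?P = "R ** matrix_inv ?S ** transpose X"
  have "transpose (matrix_inv ?S) = matrix_inv ?S"
    by (simp add: transpose_matrix_inv[OF det_Gram_columns_nonzero[OF rank_X]] matrix_transpose_mul)
  then have "?P ** transpose ?P = R ** (matrix_inv ?S ** ?S) ** matrix_inv ?S ** transpose R"
    by (simp add: matrix_transpose_mul matrix_mul_assoc)
  also have "\<dots> = R ** matrix_inv ?S ** transpose R"
    by (simp add: matrix_inv_nonsingular[OF det_Gram_columns_nonzero[OF rank_X]])
  finally have eq: "?P ** transpose ?P = R ** matrix_inv ?S ** transpose R" .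
  have "?P *v (X *v \<beta>) = R *v \<beta>" for \<beta>
  proof -
    have "?P *v (X *v \<beta>) = R *v beta_hat X (X *v \<beta>)"
      by (simp only: beta_hat_def matrix_vector_mul_assoc matrix_mul_assoc)
    then show ?thesis
      by (simp only: beta_hat_regression[OF rank_X])
  qed
  moreover have "surj ((*v) R)"
    using rank_R full_rank_surjective by blast
  ultimately have "surj ((*v) ?P)"
    unfolding surj_def by metis
  then show ?thesis
    using det_Gram_nonzero[of ?P] full_rank_surjective[of ?P] eq by simp
qed

text \<open>The variance estimate vanishes exactly on the column space, so the default value of
  \<open>T_uc\<close> coincides with the singular branch of \<open>wald\<close>.\<close>

lemma T_uc_eq_wald:
  fixes X :: "real ^ 'k ^ 'n" and R :: "real ^ 'k ^ 'q"
  assumes "CARD('k) < CARD('n)" "rank X = CARD('k)" "rank R = CARD('q)"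
  shows "T_uc X R r = (\<lambda>y. wald (sigma2_hat X y *\<^sub>R (R ** matrix_inv (transpose X ** X) ** transpose R))
    (R *v beta_hat X y - r))"
  using assms(1) det_restriction_cov[OF assms(2,3)]
  by (auto simp: fun_eq_iff T_uc_def wald_def det_scaleR sigma2_hat_def simp flip: u_hat_eq_0_iff[OF assms(2)])

lemma T_Het_eq_wald: "T_Het X R r d = (\<lambda>y. wald (Omega_Het X R d y) (R *v beta_hat X y - r))"
  by (simp add: fun_eq_iff T_Het_def wald_def)

lemma matrix_add_rdistrib: "(A + B) ** C = A ** C + B ** C" for A B :: "real ^ 'm ^ 'n"
  by (simp add: matrix_matrix_mult_def vec_eq_iff distrib_right sum.distrib)

text \<open>\<open>Omega_Het\<close> depends on \<open>y\<close> only through its diagonal factor,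
  so this linearity yields both its continuity and its homogeneity.\<close>

lemma linear_mult_diag_mat_mult: "linear (\<lambda>v. A ** diag_mat v ** B)"
  by (rule linearI)
     (simp_all add: linear_add[OF linear_diag_mat] linear_scale[OF linear_diag_mat]
       matrix_add_ldistrib matrix_add_rdistrib matrix_scalar_ac scalar_matrix_assoc)

lemma Omega_Het_eq: "Omega_Het X R d y =
   (R ** matrix_inv (transpose X ** X) ** transpose X) ** diag_mat (\<chi> i. d $ i * (u_hat X y $ i)\<^sup>2)
     ** (X ** matrix_inv (transpose X ** X) ** transpose R)"
  by (simp add: Omega_Het_def matrix_mul_assoc)

lemma continuous_on_Omega_Het: "continuous_on S (Omega_Het X R d)"
  unfolding Omega_Het_eq[abs_def]
  by (intro linear_continuous_on_compose[OF _ linear_mult_diag_mat_mult] continuous_intros continuous_on_u_hat)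

lemma Omega_Het_affine:
  fixes X :: "real ^ 'k ^ 'n"
  assumes "rank X = CARD('k)" "\<mu> \<in> M0 X R r"
  shows "Omega_Het X R d (\<mu> + c *\<^sub>R w) = c\<^sup>2 *\<^sub>R Omega_Het X R d w"
proof -
  have "(\<chi> i. d $ i * (u_hat X (\<mu> + c *\<^sub>R w) $ i)\<^sup>2) = c\<^sup>2 *\<^sub>R (\<chi> i. d $ i * (u_hat X w $ i)\<^sup>2)"
    by (simp add: u_hat_affine[OF assms] vec_eq_iff power_mult_distrib)
  then show ?thesis
    unfolding Omega_Het_eq by (simp only: linear_scale[OF linear_mult_diag_mat_mult])
qed

text \<open>Splitting each weight as a product of square roots exhibits \<open>Omega_Het\<close> as
  the Gram matrix of \<open>?B ** ?D\<close>. Outside \<open>B_set\<close> the matrix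
  \<open>?B\<close> is onto, and \<open>?D\<close> is onto by positivity of the weights.\<close>

lemma det_Omega_Het:
  fixes X :: "real ^ 'k ^ 'n" and R :: "real ^ 'k ^ 'q"
  assumes rank_X: "rank X = CARD('k)" and d: "\<And>i. d $ i > 0" and y: "y \<notin> B_set X R"
  shows "det (Omega_Het X R d y) \<noteq> 0"
proof -
  let ?S = "transpose X ** X"
  let ?B = "B_mat X R y"
  let ?D = "diag_mat (\<chi> i. sqrt (d $ i))"
  have "transpose (matrix_inv ?S) = matrix_inv ?S"
    by (simp add: transpose_matrix_inv[OF det_Gram_columns_nonzero[OF rank_X]] matrix_transpose_mul)
  moreover have "diag_mat (\<chi> i. d $ i * (u_hat X y $ i)\<^sup>2) = diag_mat (u_hat X y) ** ?D ** (?D ** diag_mat (u_hat X y))"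
  proof -
    have "d $ i * u\<^sup>2 = u * sqrt (d $ i) * (sqrt (d $ i) * u)" for i u
    proof -
      have "u * sqrt (d $ i) * (sqrt (d $ i) * u) = (sqrt (d $ i))\<^sup>2 * u\<^sup>2"
        by algebra
      then show ?thesis
        using d[of i] by simp
    qed
    then show ?thesis
      by (simp only: diag_mat_mult vec_lambda_beta)
  qed
  ultimately have eq: "(?B ** ?D) ** transpose (?B ** ?D) = Omega_Het X R d y"
    by (simp add: Omega_Het_def B_mat_def matrix_transpose_mul matrix_mul_assoc)
  have "rank ?B = CARD('q)"
    using y rank_bound[of ?B] by (simp add: B_set_def)
  then have "surj ((*v) ?B)"
    using full_rank_surjective by blast
  moreover have "surj ((*v) ?D)"
  proof (rule surjI)
    show "?D *v (\<chi> i. x $ i / sqrt (d $ i)) = x" for x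
      using d by (simp add: diag_mat_mult_vec vec_eq_iff less_imp_neq[symmetric])
  qed
  moreover have "(*v) (?B ** ?D) = (*v) ?B \<circ> (*v) ?D"
    by (simp add: fun_eq_iff matrix_vector_mul_assoc)
  ultimately have "surj ((*v) (?B ** ?D))"
    using comp_surj by metis
  then show ?thesis
    using det_Gram_nonzero[of "?B ** ?D"] full_rank_surjective[of "?B ** ?D"] eq by simp
qed

theorem proposition5p5:
  fixes X :: "real ^ 'k ^ 'n" and R :: "real ^ 'k ^ 'q" and r :: "real ^ 'q"
    and d :: "real ^ 'n"
  assumes "CARD('k) < CARD('n)"
    and "rank X = CARD('k)"
    and "rank R = CARD('q)"
    and "\<forall>i. d $ i > 0"
  shows
    "((\<forall>i\<in>I1 (M0_lin X R). axis i 1 \<notin> span (columns X)) \<longrightarrow>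
       (\<forall>\<mu>\<in>M0 X R r. \<forall>\<nu>\<in>M0 X R r.
          C_star X R (T_uc X R r) \<mu> = C_star X R (T_uc X R r) \<nu>) \<and>
       (\<forall>\<mu>\<in>M0 X R r.
          (\<forall>\<alpha> C\<alpha> :: real. 0 < \<alpha> \<and> \<alpha> < 1 \<and>
             (SUP \<mu>0\<in>M0 X R r. SUP \<sigma>2\<in>{0<..}. SUP \<Sigma>\<in>C_Het.
                measure (gaussian \<mu>0 (\<sigma>2 *\<^sub>R \<Sigma>)) {y. T_uc X R r y \<ge> C\<alpha>}) \<le> \<alpha>
             \<longrightarrow> C\<alpha> \<ge> C_star X R (T_uc X R r) \<mu>) \<and>
          (\<forall>C < C_star X R (T_uc X R r) \<mu>. \<forall>\<mu>0\<in>M0 X R r. \<forall>\<sigma>2>0.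
             (SUP \<Sigma>\<in>C_Het.
                measure (gaussian \<mu>0 (\<sigma>2 *\<^sub>R \<Sigma>)) {y. T_uc X R r y \<ge> C}) = 1)))
     \<and>
     (assumption1 X R \<and> (\<forall>i\<in>I1 (M0_lin X R). axis i 1 \<notin> B_set X R) \<longrightarrow>
       (\<forall>\<mu>\<in>M0 X R r. \<forall>\<nu>\<in>M0 X R r.
          C_star X R (T_Het X R r d) \<mu> = C_star X R (T_Het X R r d) \<nu>) \<and>
       (\<forall>\<mu>\<in>M0 X R r.
          (\<forall>\<alpha> C\<alpha> :: real. 0 < \<alpha> \<and> \<alpha> < 1 \<and>
             (SUP \<mu>0\<in>M0 X R r. SUP \<sigma>2\<in>{0<..}. SUP \<Sigma>\<in>C_Het.
                measure (gaussian \<mu>0 (\<sigma>2 *\<^sub>R \<Sigma>)) {y. T_Het X R r d y \<ge> C\<alpha>}) \<le> \<alpha>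
             \<longrightarrow> C\<alpha> \<ge> C_star X R (T_Het X R r d) \<mu>) \<and>
          (\<forall>C < C_star X R (T_Het X R r d) \<mu>. \<forall>\<mu>0\<in>M0 X R r. \<forall>\<sigma>2>0.
             (SUP \<Sigma>\<in>C_Het.
                measure (gaussian \<mu>0 (\<sigma>2 *\<^sub>R \<Sigma>)) {y. T_Het X R r d y \<ge> C}) = 1)))"
proof ((rule conjI; rule impI), goal_cases)
  case 1
  let ?G = "R ** matrix_inv (transpose X ** X) ** transpose R"
  show ?case
  proof (rule wald_size_lower_bound[OF assms(1,2) T_uc_eq_wald[OF assms(1,2,3)]])
    show "continuous_on UNIV (\<lambda>y. sigma2_hat X y *\<^sub>R ?G)"
      unfolding sigma2_hat_def using assms(1) by (intro continuous_intros continuous_on_u_hat) auto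
    show "sigma2_hat X (\<mu> + c *\<^sub>R w) *\<^sub>R ?G = c\<^sup>2 *\<^sub>R sigma2_hat X w *\<^sub>R ?G"
      if "\<mu> \<in> M0 X R r" for \<mu> c w
      by (simp add: sigma2_hat_def u_hat_affine[OF assms(2) that] power2_eq_square)
    \<comment> \<open>A basis vector outside the column space has a nonzero residual, so the scalar
      factor is nonzero.\<close>
    show "det (sigma2_hat X (axis i 1) *\<^sub>R ?G) \<noteq> 0" if "i \<in> I1 (M0_lin X R)" for i
      using 1 that assms(1) det_restriction_cov[OF assms(2,3)] u_hat_eq_0_iff[OF assms(2)]
      by (simp add: det_scaleR sigma2_hat_def)
  qed
next
  case 2
  then show ?case
    using assms(4)
    by (intro wald_size_lower_bound[OF assms(1,2) T_Het_eq_wald] continuous_on_Omega_Het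
        Omega_Het_affine det_Omega_Het assms) auto
qed

end
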